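(* Let $n\ge 2$ and $1\le p\le n-1$. Then $$\operatorname{rank} RSS'_n(p)=\binom{n-1}{p-1}+\sum_{r=p}^{n-1}\binom{n-1}{r}\binom{r-1}{p-1}.$$
   Context: Let $[n]=\{1,2,\dots,n\}$ with its usual order. $\mathcal{P}_n$ is the semigroup of all partial transformations of $[n]$ (maps whose domain and image are subsets of $[n]$, including the empty map), composed from left to right: $x(\alpha\beta)=(x\alpha)\beta$. A partial map $\alpha$ is isotone if $x\le y$ implies $x\alpha\le y\alpha$ for all $x,y\in\mathrm{Dom}\,\alpha$, and order-decreasing if $x\alpha\le x$ for all $x\in\mathrm{Dom}\,\alpha$. $\mathcal{LS}_n$ is the monoid of all isotone order-decreasing $\alpha\in\mathcal{P}_n$, and $\mathcal{SS}'_n=\{\alpha\in\mathcal{LS}_n: 1\notin \mathrm{Dom}\,\alpha\}$, a subsemigroup of $\mathcal{LS}_n$. For $0\le p\le n-1$, $K(n,p)=\{\alpha\in\mathcal{SS}'_n: |\mathrm{Im}\,\alpha|\le p\}$, a two-sided ideal of $\mathcal{SS}'_n$. For $1\le p\le n-1$, $RSS'_n(p)=K(n,p)/K(n,p-1)$ is the Rees quotient semigroup: its elements are $0$ and the elements of $\mathcal{SS}'_n$ with image of size exactly $p$, and the product of two nonzero elements is their product in $\mathcal{SS}'_n$ if that product has image of size $p$, and $0$ otherwise. The rank of a finitely generated semigroup $S$ is $\operatorname{rank}(S)=\min\{|A|: A\subseteq S,\ \langle A\rangle=S\}$, where $\langle A\rangle$ is the subsemigroup generated by $A$. *)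

theory Defs
  imports Main
begin

text \<open>Partial maps are elements of \<^typ>\<open>nat \<rightharpoonup> nat\<close>; the empty map is \<^const>\<open>Map.empty\<close>.
  Points of the chain are the naturals \<open>1, \<dots>, n\<close>.\<close>

definition partial_transformations :: "nat \<Rightarrow> (nat \<rightharpoonup> nat) set" where
  "partial_transformations n = {\<alpha>. dom \<alpha> \<subseteq> {1..n} \<and> ran \<alpha> \<subseteq> {1..n}}"

text \<open>Composition is from left to right: first \<open>\<alpha>\<close>, then \<open>\<beta>\<close>.\<close>

definition pt_mult :: "(nat \<rightharpoonup> nat) \<Rightarrow> (nat \<rightharpoonup> nat) \<Rightarrow> (nat \<rightharpoonup> nat)" where
  "pt_mult \<alpha> \<beta> = \<beta> \<circ>\<^sub>m \<alpha>"

definition isotone :: "(nat \<rightharpoonup> nat) \<Rightarrow> bool" where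
  "isotone \<alpha> \<longleftrightarrow> mono_on (dom \<alpha>) (\<lambda>x. the (\<alpha> x))"

definition order_decreasing :: "(nat \<rightharpoonup> nat) \<Rightarrow> bool" where
  "order_decreasing \<alpha> \<longleftrightarrow> (\<forall>x\<in>dom \<alpha>. the (\<alpha> x) \<le> x)"

definition LS :: "nat \<Rightarrow> (nat \<rightharpoonup> nat) set" where
  "LS n = {\<alpha> \<in> partial_transformations n. isotone \<alpha> \<and> order_decreasing \<alpha>}"

definition SS' :: "nat \<Rightarrow> (nat \<rightharpoonup> nat) set" where
  "SS' n = {\<alpha> \<in> LS n. 1 \<notin> dom \<alpha>}"

definition K :: "nat \<Rightarrow> nat \<Rightarrow> (nat \<rightharpoonup> nat) set" where
  "K n p = {\<alpha> \<in> SS' n. card (ran \<alpha>) \<le> p}"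

text \<open>The Rees quotient of a semigroup with carrier \<open>S\<close> by an ideal \<open>I\<close>: the class \<open>I\<close> is
  represented by \<^const>\<open>None\<close> (the zero), the singleton class of \<open>a \<in> S - I\<close> by \<open>Some a\<close>.\<close>

definition rees_carrier :: "'a set \<Rightarrow> 'a set \<Rightarrow> 'a option set" where
  "rees_carrier S I = insert None (Some ` (S - I))"

fun rees_mult :: "('a \<Rightarrow> 'a \<Rightarrow> 'a) \<Rightarrow> 'a set \<Rightarrow> 'a option \<Rightarrow> 'a option \<Rightarrow> 'a option" where
  "rees_mult f I (Some a) (Some b) = (if f a b \<in> I then None else Some (f a b))"
| "rees_mult f I None y = None"
| "rees_mult f I x None = None"

definition RSS' :: "nat \<Rightarrow> nat \<Rightarrow> (nat \<rightharpoonup> nat) option set" where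
  "RSS' n p = rees_carrier (K n p) (K n (p - 1))"

definition RSS'_mult ::
    "nat \<Rightarrow> nat \<Rightarrow> (nat \<rightharpoonup> nat) option \<Rightarrow> (nat \<rightharpoonup> nat) option \<Rightarrow> (nat \<rightharpoonup> nat) option" where
  "RSS'_mult n p = rees_mult pt_mult (K n (p - 1))"

inductive_set generated_subsemigroup :: "('a \<Rightarrow> 'a \<Rightarrow> 'a) \<Rightarrow> 'a set \<Rightarrow> 'a set"
  for f :: "'a \<Rightarrow> 'a \<Rightarrow> 'a" and A :: "'a set" where
  incl: "a \<in> A \<Longrightarrow> a \<in> generated_subsemigroup f A"
| mult: "\<lbrakk>a \<in> generated_subsemigroup f A; b \<in> generated_subsemigroup f A\<rbrakk>
    \<Longrightarrow> f a b \<in> generated_subsemigroup f A"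

text \<open>Meaningful for finitely generated semigroups only; finiteness of \<open>A\<close> is demanded because
  \<^const>\<open>card\<close> is \<open>0\<close> on infinite sets.\<close>

definition semigroup_rank :: "'a set \<Rightarrow> ('a \<Rightarrow> 'a \<Rightarrow> 'a) \<Rightarrow> nat" where
  "semigroup_rank S f =
    (LEAST k. \<exists>A. A \<subseteq> S \<and> finite A \<and> generated_subsemigroup f A = S \<and> card A = k)"

end

theory Submission
  imports Defs
begin

text \<open>The rank-\<open>p\<close> idempotents collapse convex blocks of their domain to their minima. In any
  factorization of such an idempotent into rank-\<open>p\<close> factors the first factor is the idempotent
  itself, so every generating set contains all of them; they are counted by the pairs
  (domain, image). A product inherits the image of its last factor, so every generating set also
  contains, for each \<open>p\<close>-set \<open>B\<close> with \<open>1 \<in> B\<close>, an element with image \<open>B\<close>, which is not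
  idempotent. Conversely, a map whose image avoids \<open>1\<close> is a product of idempotents, by moving
  one image point at a time, and the maps with image \<open>B\<close> all factor through the one whose
  domain is pointwise smallest.\<close>

section \<open>Maps of \<open>SS' n\<close> and their products\<close>

definition SS_rank :: "nat \<Rightarrow> nat \<Rightarrow> (nat \<rightharpoonup> nat) set" where
  "SS_rank n p = {\<alpha> \<in> SS' n. card (ran \<alpha>) = p}"

text \<open>Fixing every point of the image is the pointwise form of idempotency.\<close>

definition SS_idem :: "nat \<Rightarrow> nat \<Rightarrow> (nat \<rightharpoonup> nat) set" where
  "SS_idem n p = {\<alpha> \<in> SS_rank n p. \<forall>y\<in>ran \<alpha>. \<alpha> y = Some y}"

lemma SS'_iff:
  "\<alpha> \<in> SS' n \<longleftrightarrow> dom \<alpha> \<subseteq> {2..n} \<and> (\<forall>x y. \<alpha> x = Some y \<longrightarrow> 1 \<le> y \<and> y \<le> x) \<and>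
    (\<forall>x x' y y'. \<alpha> x = Some y \<longrightarrow> \<alpha> x' = Some y' \<longrightarrow> x \<le> x' \<longrightarrow> y \<le> y')"
  (is "?L \<longleftrightarrow> ?R")
proof
  assume L: ?L
  then have d: "dom \<alpha> \<subseteq> {1..n}" "ran \<alpha> \<subseteq> {1..n}" "1 \<notin> dom \<alpha>"
    and m: "\<And>x x'. x \<in> dom \<alpha> \<Longrightarrow> x' \<in> dom \<alpha> \<Longrightarrow> x \<le> x' \<Longrightarrow> the (\<alpha> x) \<le> the (\<alpha> x')"
    and o: "\<And>x. x \<in> dom \<alpha> \<Longrightarrow> the (\<alpha> x) \<le> x"
    by (auto simp: SS'_def LS_def partial_transformations_def isotone_def order_decreasing_def
        mono_on_def)
  have "dom \<alpha> \<subseteq> {2..n}"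
  proof
    fix x assume x: "x \<in> dom \<alpha>"
    then have "x \<in> {1..n}" "x \<noteq> 1" using d by blast+
    then show "x \<in> {2..n}" by auto
  qed
  moreover have "1 \<le> y \<and> y \<le> x" if "\<alpha> x = Some y" for x y
    using d(2) ranI[of \<alpha> x y] o[of x] that by (auto simp: domI)
  moreover have "y \<le> y'" if "\<alpha> x = Some y" "\<alpha> x' = Some y'" "x \<le> x'" for x x' y y'
    using m[of x x'] that by (auto simp: domI)
  ultimately show ?R by blast
next
  assume R: ?R
  then have d: "dom \<alpha> \<subseteq> {2..n}" by blast
  have "ran \<alpha> \<subseteq> {1..n}"
  proof
    fix y assume "y \<in> ran \<alpha>"
    then obtain x where x: "\<alpha> x = Some y" by (auto simp: ran_def)
    then have "x \<in> {2..n}" using d by blast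
    moreover have "1 \<le> y \<and> y \<le> x" using R x by blast
    ultimately show "y \<in> {1..n}" by auto
  qed
  moreover have "dom \<alpha> \<subseteq> {1..n}" "1 \<notin> dom \<alpha>" using d by fastforce+
  moreover have "isotone \<alpha>" using R by (force simp: isotone_def mono_on_def)
  moreover have "order_decreasing \<alpha>" using R by (force simp: order_decreasing_def)
  ultimately show ?L by (simp add: SS'_def LS_def partial_transformations_def)
qed

lemma SS'I:
  assumes "\<And>x y. \<alpha> x = Some y \<Longrightarrow> 2 \<le> x \<and> x \<le> n \<and> 1 \<le> y \<and> y \<le> x"
    and "\<And>x x' y y'. \<alpha> x = Some y \<Longrightarrow> \<alpha> x' = Some y' \<Longrightarrow> x < x' \<Longrightarrow> y \<le> y'"
  shows "\<alpha> \<in> SS' n"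
proof -
  have "y \<le> y'" if "\<alpha> x = Some y" "\<alpha> x' = Some y'" "x \<le> x'" for x x' y y'
    using assms(2)[OF that(1,2)] that by (cases "x = x'") auto
  then show ?thesis unfolding SS'_iff using assms(1) by fastforce
qed

lemma SS'D:
  assumes "\<alpha> \<in> SS' n" "\<alpha> x = Some y"
  shows "2 \<le> x" "x \<le> n" "1 \<le> y" "y \<le> x"
proof -
  have "x \<in> {2..n}" "1 \<le> y \<and> y \<le> x" using assms domI[of \<alpha>] unfolding SS'_iff by blast+
  then show "2 \<le> x" "x \<le> n" "1 \<le> y" "y \<le> x" by auto
qed

lemma SS'_mono:
  assumes "\<alpha> \<in> SS' n" "\<alpha> x = Some y" "\<alpha> x' = Some y'" "x \<le> x'"
  shows "y \<le> y'"
  using assms unfolding SS'_iff by blast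

lemma SS'_ran: "\<alpha> \<in> SS' n \<Longrightarrow> ran \<alpha> \<subseteq> {1..n}"
proof
  fix y assume S: "\<alpha> \<in> SS' n" and "y \<in> ran \<alpha>"
  then obtain x where "\<alpha> x = Some y" by (auto simp: ran_def)
  then show "y \<in> {1..n}" using SS'D[OF S] by fastforce
qed

lemma SS'_finite_ran: "\<alpha> \<in> SS' n \<Longrightarrow> finite (ran \<alpha>)"
  using SS'_ran finite_subset by blast

lemma pt_mult_eq_Some: "pt_mult \<alpha> \<beta> x = Some z \<longleftrightarrow> (\<exists>y. \<alpha> x = Some y \<and> \<beta> y = Some z)"
  by (simp add: pt_mult_def map_comp_Some_iff)

lemma pt_mult_closed:
  assumes "\<alpha> \<in> SS' n" "\<beta> \<in> SS' n"
  shows "pt_mult \<alpha> \<beta> \<in> SS' n"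
proof (rule SS'I)
  fix x z assume "pt_mult \<alpha> \<beta> x = Some z"
  then obtain y where y: "\<alpha> x = Some y" "\<beta> y = Some z" by (auto simp: pt_mult_eq_Some)
  show "2 \<le> x \<and> x \<le> n \<and> 1 \<le> z \<and> z \<le> x"
    using SS'D[OF assms(1) y(1)] SS'D[OF assms(2) y(2)] by simp
next
  fix x x' z z' assume h: "pt_mult \<alpha> \<beta> x = Some z" "pt_mult \<alpha> \<beta> x' = Some z'" "x < x'"
  then obtain y y' where y: "\<alpha> x = Some y" "\<beta> y = Some z" "\<alpha> x' = Some y'" "\<beta> y' = Some z'"
    by (auto simp: pt_mult_eq_Some)
  then show "z \<le> z'"
    using SS'_mono[OF assms(1) y(1,3)] SS'_mono[OF assms(2) y(2,4)] h by simp
qed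

lemma ran_pt_mult: "ran (pt_mult \<alpha> \<beta>) \<subseteq> ran \<beta>"
  by (auto simp: ran_def pt_mult_eq_Some)

section \<open>Multiplication in the Rees quotient\<close>

lemma RSS'_eq:
  assumes "1 \<le> p"
  shows "RSS' n p = insert None (Some ` SS_rank n p)"
proof -
  have "K n p - K n (p - 1) = SS_rank n p"
    using assms by (auto simp: K_def SS_rank_def)
  then show ?thesis by (simp add: RSS'_def rees_carrier_def)
qed

text \<open>The image of a product lies in that of its last factor, so its rank is at most p. Hence
  avoiding the ideal \<open>K n (p - 1)\<close> is the same as having rank exactly p.\<close>

lemma RSS'_mult_eq_Some:
  assumes "1 \<le> p" "a \<in> RSS' n p" "b \<in> RSS' n p"
  shows "RSS'_mult n p a b = Some \<gamma> \<longleftrightarrow>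
    (\<exists>\<alpha> \<beta>. a = Some \<alpha> \<and> b = Some \<beta> \<and> \<gamma> = pt_mult \<alpha> \<beta> \<and> \<gamma> \<in> SS_rank n p)"
proof (cases "a = None \<or> b = None")
  case True
  then show ?thesis by (cases a; cases b) (auto simp: RSS'_mult_def)
next
  case False
  then obtain \<alpha> \<beta> where ab: "a = Some \<alpha>" "b = Some \<beta>" "\<alpha> \<in> SS_rank n p" "\<beta> \<in> SS_rank n p"
    using assms(2,3) by (auto simp: RSS'_eq[OF assms(1)])
  have "pt_mult \<alpha> \<beta> \<in> SS' n" using pt_mult_closed ab by (simp add: SS_rank_def)
  moreover have "card (ran (pt_mult \<alpha> \<beta>)) \<le> p"
    using card_mono[OF SS'_finite_ran ran_pt_mult] ab(4) by (fastforce simp: SS_rank_def)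
  ultimately have "pt_mult \<alpha> \<beta> \<in> K n (p - 1) \<longleftrightarrow> pt_mult \<alpha> \<beta> \<notin> SS_rank n p"
    using assms(1) by (auto simp: K_def SS_rank_def)
  then show ?thesis using ab by (auto simp: RSS'_mult_def)
qed

lemma RSS'_mult_closed:
  assumes "1 \<le> p" "a \<in> RSS' n p" "b \<in> RSS' n p"
  shows "RSS'_mult n p a b \<in> RSS' n p"
  using RSS'_mult_eq_Some[OF assms]
  by (cases "RSS'_mult n p a b") (auto simp: RSS'_eq[OF assms(1)])

lemma generated_subset_RSS':
  assumes "1 \<le> p" "A \<subseteq> RSS' n p"
  shows "generated_subsemigroup (RSS'_mult n p) A \<subseteq> RSS' n p"
proof
  fix x assume "x \<in> generated_subsemigroup (RSS'_mult n p) A"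
  then show "x \<in> RSS' n p"
    by induction (use assms RSS'_mult_closed in auto)
qed

section \<open>Elements forced into every generating set\<close>

lemma ran_pt_mult_eq:
  assumes "\<beta> \<in> SS_rank n p" "pt_mult \<alpha> \<beta> \<in> SS_rank n p"
  shows "ran (pt_mult \<alpha> \<beta>) = ran \<beta>"
  using assms card_subset_eq[OF SS'_finite_ran ran_pt_mult]
  by (fastforce simp: SS_rank_def)

text \<open>Equality of ranks makes \<beta> defined and injective on the image of \<alpha>. If x
  goes to w and then to y, idempotency gives a round trip y, v, y through the two factors; both are
  decreasing, so v = y. Now \<beta> sends w and y to the same point, whence w = y.\<close>

lemma SS_idem_left_factor:
  assumes "\<alpha> \<in> SS_rank n p" "\<beta> \<in> SS_rank n p" "pt_mult \<alpha> \<beta> \<in> SS_idem n p"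
  shows "pt_mult \<alpha> \<beta> = \<alpha>"
proof
  let ?e = "pt_mult \<alpha> \<beta>"
  let ?g = "\<lambda>y. the (\<beta> y)"
  have S: "\<alpha> \<in> SS' n" "\<beta> \<in> SS' n" and c: "card (ran \<alpha>) = p" "card (ran ?e) = p"
    and e: "\<And>y. y \<in> ran ?e \<Longrightarrow> ?e y = Some y"
    using assms by (auto simp: SS_rank_def SS_idem_def)
  have fin: "finite (ran \<alpha>)" using S SS'_finite_ran by blast
  have "ran ?e \<subseteq> ?g ` (ran \<alpha> \<inter> dom \<beta>)"
  proof
    fix z assume "z \<in> ran ?e"
    then obtain x y where "\<alpha> x = Some y" "\<beta> y = Some z"
      by (auto simp: ran_def pt_mult_eq_Some)
    then show "z \<in> ?g ` (ran \<alpha> \<inter> dom \<beta>)"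
      by (intro image_eqI[of _ _ y]) (auto intro: ranI)
  qed
  \<comment> \<open>The image of \<open>ran \<alpha> \<inter> dom \<beta>\<close> under
    \<open>?g\<close> has at least p points, while \<open>ran \<alpha>\<close> has only p. This
    yields both that \<beta> is defined on all of \<open>ran \<alpha>\<close> and that it is
    injective there.\<close>
  then have le: "p \<le> card (?g ` (ran \<alpha> \<inter> dom \<beta>))"
    using c card_mono fin by (metis finite_Int finite_imageI)
  also have "\<dots> \<le> card (ran \<alpha> \<inter> dom \<beta>)" by (intro card_image_le) (use fin in auto)
  finally have sub: "ran \<alpha> \<inter> dom \<beta> = ran \<alpha>"
    using c fin by (intro card_seteq) auto
  have inj: "inj_on ?g (ran \<alpha>)"
    using le card_image_le[OF fin, of ?g] by (intro eq_card_imp_inj_on) (auto simp: sub c fin)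
  fix x
  show "?e x = \<alpha> x"
  proof (cases "\<alpha> x")
    case None
    then show ?thesis by (simp add: pt_mult_def)
  next
    case (Some w)
    then have w: "w \<in> ran \<alpha>" by (rule ranI)
    then obtain y where y: "\<beta> w = Some y" using sub by blast
    then have ex: "?e x = Some y" using Some by (auto simp: pt_mult_eq_Some)
    then have "?e y = Some y" by (intro e ranI)
    then obtain v where v: "\<alpha> y = Some v" "\<beta> v = Some y" by (auto simp: pt_mult_eq_Some)
    then have "v = y" using SS'D[OF S(1) v(1)] SS'D[OF S(2) v(2)] by simp
    then have "?g w = ?g y" "y \<in> ran \<alpha>" using v y by (auto intro: ranI)
    then have "w = y" using inj w by (auto dest: inj_onD)
    then show ?thesis using ex Some by simp
  qed
qed

text \<open>Induction along the left factor: in a product equal to \<epsilon> the left factor is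
  again \<epsilon>, so descending on the left ends at a generator equal to \<epsilon>.\<close>

lemma SS_idem_in_generators:
  assumes p: "1 \<le> p" and A: "A \<subseteq> RSS' n p"
    and "Some \<epsilon> \<in> generated_subsemigroup (RSS'_mult n p) A" "\<epsilon> \<in> SS_idem n p"
  shows "Some \<epsilon> \<in> A"
  using assms(3,4)
proof (induction "Some \<epsilon>" arbitrary: \<epsilon>)
  case (mult a b)
  have ab: "a \<in> RSS' n p" "b \<in> RSS' n p"
    using mult generated_subset_RSS'[OF p A] by blast+
  then obtain \<alpha> \<beta> where f: "a = Some \<alpha>" "b = Some \<beta>" "\<epsilon> = pt_mult \<alpha> \<beta>"
    using RSS'_mult_eq_Some[OF p ab, of \<epsilon>] mult.hyps by metis
  have "\<alpha> \<in> SS_rank n p" "\<beta> \<in> SS_rank n p" using ab f by (auto simp: RSS'_eq[OF p])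
  then have "\<epsilon> = \<alpha>" using SS_idem_left_factor mult.prems f by metis
  then show ?case using mult f by blast
qed

text \<open>Induction along the right factor, which keeps the image of a nonzero product.\<close>

lemma ran_in_generators:
  assumes p: "1 \<le> p" and A: "A \<subseteq> RSS' n p"
    and "Some \<alpha> \<in> generated_subsemigroup (RSS'_mult n p) A"
  shows "\<exists>\<gamma>. Some \<gamma> \<in> A \<and> ran \<gamma> = ran \<alpha>"
  using assms(3)
proof (induction "Some \<alpha>" arbitrary: \<alpha>)
  case incl
  then show ?case by blast
next
  case (mult a b)
  have ab: "a \<in> RSS' n p" "b \<in> RSS' n p"
    using mult generated_subset_RSS'[OF p A] by blast+
  then obtain \<beta> \<gamma> where f: "a = Some \<beta>" "b = Some \<gamma>" "\<alpha> = pt_mult \<beta> \<gamma>" "\<alpha> \<in> SS_rank n p"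
    using RSS'_mult_eq_Some[OF p ab, of \<alpha>] mult.hyps by metis
  have "\<gamma> \<in> SS_rank n p" using ab f by (auto simp: RSS'_eq[OF p])
  then have "ran \<alpha> = ran \<gamma>" using ran_pt_mult_eq f by metis
  then show ?case using mult f by metis
qed

section \<open>Generating the maps whose image avoids 1\<close>

lemma generated_pt_mult:
  assumes "1 \<le> p" "A \<subseteq> RSS' n p" "pt_mult \<alpha> \<beta> \<in> SS_rank n p"
    and "Some \<alpha> \<in> generated_subsemigroup (RSS'_mult n p) A"
    and "Some \<beta> \<in> generated_subsemigroup (RSS'_mult n p) A"
  shows "Some (pt_mult \<alpha> \<beta>) \<in> generated_subsemigroup (RSS'_mult n p) A"
proof -
  have "Some \<alpha> \<in> RSS' n p" "Some \<beta> \<in> RSS' n p"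
    using assms generated_subset_RSS' by blast+
  then have "RSS'_mult n p (Some \<alpha>) (Some \<beta>) = Some (pt_mult \<alpha> \<beta>)"
    using RSS'_mult_eq_Some assms by blast
  then show ?thesis using generated_subsemigroup.mult assms(4,5) by metis
qed

text \<open>Let b be the largest image point that is not fixed and a its least preimage. The map
  \<beta> stops at a wherever \<alpha> goes to b, and \<epsilon> carries a down to b while fixing
  the image of \<alpha>. In \<beta> the unfixed image point b is replaced by the fixed point
  a.\<close>

lemma SS_rank_avoiding_1_factor:
  assumes \<alpha>: "\<alpha> \<in> SS_rank n p" "1 \<notin> ran \<alpha>" "\<alpha> \<notin> SS_idem n p"
  obtains \<beta> \<epsilon> where "\<beta> \<in> SS_rank n p" "1 \<notin> ran \<beta>" "\<epsilon> \<in> SS_idem n p" "\<alpha> = pt_mult \<beta> \<epsilon>"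
    "card {y \<in> ran \<beta>. \<beta> y \<noteq> Some y} < card {y \<in> ran \<alpha>. \<alpha> y \<noteq> Some y}"
proof -
  let ?bad = "\<lambda>\<alpha>. {y \<in> ran \<alpha>. \<alpha> y \<noteq> Some y}"
  have S: "\<alpha> \<in> SS' n" and c: "card (ran \<alpha>) = p" using \<alpha> by (auto simp: SS_rank_def)
  have fin: "finite (?bad \<alpha>)" "finite (ran \<alpha>)" using SS'_finite_ran[OF S] by auto
  have "?bad \<alpha> \<noteq> {}" using \<alpha> by (auto simp: SS_idem_def)
  define b where "b = Max (?bad \<alpha>)"
  have b: "b \<in> ran \<alpha>" "\<alpha> b \<noteq> Some b"
    using Max_in[OF fin(1) \<open>?bad \<alpha> \<noteq> {}\<close>] by (auto simp: b_def)
  have fix_above: "\<alpha> y = Some y" if "y \<in> ran \<alpha>" "b < y" for y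
    using Max_ge[OF fin(1), of y] that by (fastforce simp: b_def)
  \<comment> \<open>Choosing the least preimage keeps \<beta> decreasing: every point that is sent
    to a is at least a.\<close>
  define a where "a = (LEAST x. \<alpha> x = Some b)"
  have "\<exists>x. \<alpha> x = Some b" using b by (auto simp: ran_def)
  then have a: "\<alpha> a = Some b" unfolding a_def by (rule LeastI_ex)
  have a_le: "a \<le> x" if "\<alpha> x = Some b" for x
    unfolding a_def using that by (rule Least_le)
  have "b < a" using SS'D[OF S a] b a by (cases "a = b") auto
  have a_notin: "a \<notin> ran \<alpha>" using fix_above \<open>b < a\<close> a by fastforce
  \<comment> \<open>A fixed point y with b < y \<le> a would give y \<le> b by monotonicity. So no
    image point lies strictly between b and a, and raising b to a preserves the order.\<close>
  have above: "a < y" if "y \<in> ran \<alpha>" "b < y" for y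
    using SS'_mono[OF S fix_above[OF that] a] that by fastforce
  define \<beta> where "\<beta> = (\<lambda>x. if \<alpha> x = Some b then Some a else \<alpha> x)"
  define \<epsilon> where "\<epsilon> = (\<lambda>z. if z = a then Some b else if z \<in> ran \<alpha> then Some z else None)"
  have ran\<beta>: "ran \<beta> = insert a (ran \<alpha> - {b})"
  proof (intro equalityI subsetI)
    fix y assume "y \<in> ran \<beta>"
    then show "y \<in> insert a (ran \<alpha> - {b})" by (auto simp: ran_def \<beta>_def split: if_splits)
  next
    fix y assume y: "y \<in> insert a (ran \<alpha> - {b})"
    show "y \<in> ran \<beta>"
    proof (cases "y = a")
      case True
      then have "\<beta> a = Some y" using a by (simp add: \<beta>_def)
      then show ?thesis by (rule ranI)
    next
      case False
      then obtain x where "\<alpha> x = Some y" "y \<noteq> b" using y by (auto simp: ran_def)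
      then have "\<beta> x = Some y" by (simp add: \<beta>_def)
      then show ?thesis by (rule ranI)
    qed
  qed
  have ran\<epsilon>: "ran \<epsilon> = ran \<alpha>"
    using b a_notin by (auto simp: ran_def \<epsilon>_def)
  have "\<beta> \<in> SS' n"
  proof (rule SS'I)
    fix x y assume "\<beta> x = Some y"
    then show "2 \<le> x \<and> x \<le> n \<and> 1 \<le> y \<and> y \<le> x"
      using SS'D[OF S, of x] a_le[of x] \<open>b < a\<close> by (auto simp: \<beta>_def split: if_splits)
  next
    fix x x' y y' assume h: "\<beta> x = Some y" "\<beta> x' = Some y'" "x < x'"
    show "y \<le> y'"
      using h SS'_mono[OF S, of x _ x'] above[of y'] \<open>b < a\<close> ranI[of \<alpha> x' y']
      by (fastforce simp: \<beta>_def split: if_splits)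
  qed
  moreover have "card (ran \<beta>) = p"
    using c a_notin fin(2) card.remove[OF fin(2) b(1)] by (simp add: ran\<beta>)
  ultimately have \<beta>: "\<beta> \<in> SS_rank n p" by (simp add: SS_rank_def)
  have one\<beta>: "1 \<notin> ran \<beta>" using \<alpha>(2) SS'D[OF S a] by (auto simp: ran\<beta>)
  have "\<epsilon> \<in> SS' n"
  proof (rule SS'I)
    fix x y assume "\<epsilon> x = Some y"
    \<comment> \<open>Since \<epsilon> fixes the image of \<alpha>, that image becomes part of its
      domain and so must not contain 1.\<close>
    moreover have "2 \<le> x \<and> x \<le> n" if "x \<in> ran \<alpha>"
    proof -
      have "x \<in> {1..n}" "x \<noteq> 1" using that SS'_ran[OF S] \<alpha>(2) by blast+
      then show ?thesis by auto
    qed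
    ultimately show "2 \<le> x \<and> x \<le> n \<and> 1 \<le> y \<and> y \<le> x"
      using SS'D[OF S a] \<open>b < a\<close> by (auto simp: \<epsilon>_def split: if_splits)
  next
    fix x x' y y' assume "\<epsilon> x = Some y" "\<epsilon> x' = Some y'" "x < x'"
    then show "y \<le> y'"
      using above[of x] \<open>b < a\<close> by (fastforce simp: \<epsilon>_def split: if_splits)
  qed
  then have \<epsilon>: "\<epsilon> \<in> SS_idem n p"
    using c a_notin by (auto simp: SS_idem_def SS_rank_def ran\<epsilon>) (auto simp: \<epsilon>_def)
  have eq: "\<alpha> = pt_mult \<beta> \<epsilon>"
  proof
    fix x show "\<alpha> x = pt_mult \<beta> \<epsilon> x"
      using a_notin ranI[of \<alpha> x]
      by (cases "\<alpha> x") (auto simp: pt_mult_def map_comp_def \<beta>_def \<epsilon>_def)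
  qed
  have "?bad \<beta> \<subseteq> ?bad \<alpha> - {b}"
    using a by (auto simp: ran\<beta>) (auto simp: \<beta>_def split: if_splits)
  then have "card (?bad \<beta>) < card (?bad \<alpha>)"
    using b fin by (intro psubset_card_mono) auto
  then show ?thesis using that \<beta> one\<beta> \<epsilon> eq by blast
qed

lemma generated_by_SS_idem:
  assumes p: "1 \<le> p" and A: "A \<subseteq> RSS' n p" and E: "Some ` SS_idem n p \<subseteq> A"
    and "\<alpha> \<in> SS_rank n p" "1 \<notin> ran \<alpha>"
  shows "Some \<alpha> \<in> generated_subsemigroup (RSS'_mult n p) A"
  using assms(4,5)
proof (induction "card {y \<in> ran \<alpha>. \<alpha> y \<noteq> Some y}" arbitrary: \<alpha> rule: less_induct)
  case less
  have gen: "Some \<epsilon> \<in> generated_subsemigroup (RSS'_mult n p) A" if "\<epsilon> \<in> SS_idem n p" for \<epsilon>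
    using that E by (blast intro: generated_subsemigroup.incl)
  show ?case
  proof (cases "\<alpha> \<in> SS_idem n p")
    case False
    obtain \<beta> \<epsilon> where f: "\<beta> \<in> SS_rank n p" "1 \<notin> ran \<beta>" "\<epsilon> \<in> SS_idem n p" "\<alpha> = pt_mult \<beta> \<epsilon>"
      "card {y \<in> ran \<beta>. \<beta> y \<noteq> Some y} < card {y \<in> ran \<alpha>. \<alpha> y \<noteq> Some y}"
      using SS_rank_avoiding_1_factor[OF less.prems False] .
    show ?thesis
      using generated_pt_mult[OF p A _ less.hyps[OF f(5,1,2)] gen[OF f(3)]] less.prems(1) f(4)
      by simp
  qed (rule gen)
qed

section \<open>Factoring through the map with the smallest domain\<close>

text \<open>Every preimage of the \<open>i\<close>-th point \<open>b\<close> of the image \<open>B\<close> is at least \<open>b\<close> and, since \<open>1\<close>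
  is not in the domain, at least \<open>i + 1\<close>.\<close>

definition least_preimage :: "nat set \<Rightarrow> nat \<Rightarrow> nat" where
  "least_preimage B b = max b (card {c \<in> B. c \<le> b} + 1)"

definition least_map :: "nat set \<Rightarrow> nat \<rightharpoonup> nat" where
  "least_map B y = (if y \<in> least_preimage B ` B
     then Some (inv_into B (least_preimage B) y) else None)"

text \<open>Both arguments of the maximum increase strictly along B: the larger point is counted
  only in the second set.\<close>

lemma least_preimage_strict_mono:
  assumes "finite B"
  shows "strict_mono_on B (least_preimage B)"
proof (rule strict_mono_onI)
  fix b c assume "b \<in> B" "c \<in> B" "b < c"
  then have "card {x \<in> B. x \<le> b} < card {x \<in> B. x \<le> c}"
    using assms by (intro psubset_card_mono psubsetI) (auto dest!: equalityD2)
  then show "least_preimage B b < least_preimage B c"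
    using \<open>b < c\<close> by (auto simp: least_preimage_def)
qed

lemma least_preimage_ge_2:
  assumes "finite B" "b \<in> B"
  shows "2 \<le> least_preimage B b"
proof -
  have "card {c \<in> B. c \<le> b} > 0" using assms by (auto simp: card_gt_0_iff)
  then show ?thesis by (auto simp: least_preimage_def)
qed

lemma least_map_eq_Some:
  assumes "finite B"
  shows "least_map B y = Some b \<longleftrightarrow> b \<in> B \<and> y = least_preimage B b"
proof -
  have "inj_on (least_preimage B) B"
    using least_preimage_strict_mono[OF assms] by (rule strict_mono_on_imp_inj_on)
  then show ?thesis by (auto simp: least_map_def)
qed

lemma ran_least_map: "finite B \<Longrightarrow> ran (least_map B) = B"
  by (auto simp: ran_def least_map_eq_Some)

text \<open>The assumption p < n keeps the domain inside the chain, because a least preimage is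
  bounded by the larger of b and p + 1.\<close>

lemma least_map_in_SS_rank:
  assumes B: "B \<subseteq> {1..n}" "card B = p" and p: "p < n"
  shows "least_map B \<in> SS_rank n p"
proof -
  have fin: "finite B" using B finite_subset by blast
  have "least_map B \<in> SS' n"
  proof (rule SS'I)
    fix y b assume "least_map B y = Some b"
    then have b: "b \<in> B" "y = least_preimage B b" by (auto simp: least_map_eq_Some[OF fin])
    have "card {c \<in> B. c \<le> b} \<le> p"
      unfolding B(2)[symmetric] by (intro card_mono fin) auto
    moreover have "b \<in> {1..n}" using b B by blast
    ultimately show "2 \<le> y \<and> y \<le> n \<and> 1 \<le> b \<and> b \<le> y"
      using least_preimage_ge_2[OF fin b(1)] b(2) p by (auto simp: least_preimage_def)
  next
    fix y y' b b' assume "least_map B y = Some b" "least_map B y' = Some b'" "y < y'"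
    then show "b \<le> b'"
      using strict_mono_on_less_eq[OF least_preimage_strict_mono[OF fin], of b b']
      by (auto simp: least_map_eq_Some[OF fin])
  qed
  then show ?thesis using B by (simp add: SS_rank_def ran_least_map[OF fin])
qed

text \<open>Send x to the least preimage of its value under \<alpha>, then apply
  \<open>least_map\<close>. The first map is decreasing because a least preimage is a lower bound
  for actual preimages, and its image avoids 1 because least preimages are at least 2.\<close>

lemma factor_through_least_map:
  assumes \<alpha>: "\<alpha> \<in> SS_rank n p"
  obtains \<beta> where "\<beta> \<in> SS_rank n p" "1 \<notin> ran \<beta>" "\<alpha> = pt_mult \<beta> (least_map (ran \<alpha>))"
proof -
  let ?B = "ran \<alpha>"
  let ?c = "least_preimage ?B"
  have S: "\<alpha> \<in> SS' n" and c: "card ?B = p" using \<alpha> by (auto simp: SS_rank_def)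
  have fin: "finite ?B" using SS'_finite_ran[OF S] .
  have sm: "strict_mono_on ?B ?c" by (rule least_preimage_strict_mono[OF fin])
  define \<beta> where "\<beta> = (\<lambda>x. map_option ?c (\<alpha> x))"
  have ran\<beta>: "ran \<beta> = ?c ` ?B"
    by (auto simp: ran_def \<beta>_def)
  have le: "?c y \<le> x" if x: "\<alpha> x = Some y" for x y
  proof -
    \<comment> \<open>Every image point up to y is attained on \<open>{2..x}\<close>: a preimage
      beyond x has value at least y, so this value is y itself, attained at x. Since
      \<open>{2..x}\<close> has x - 1 elements, the count plus 1 is at most x.\<close>
    have "{b \<in> ?B. b \<le> y} \<subseteq> (\<lambda>x. the (\<alpha> x)) ` {2..x}"
    proof
      fix b assume "b \<in> {b \<in> ?B. b \<le> y}"
      then obtain x' where x': "\<alpha> x' = Some b" "b \<le> y" by (auto simp: ran_def)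
      show "b \<in> (\<lambda>x. the (\<alpha> x)) ` {2..x}"
      proof (cases "x' \<le> x")
        case True
        then show ?thesis using x' SS'D[OF S x'(1)] by (intro image_eqI[of _ _ x']) auto
      next
        case False
        then have "b = y" using SS'_mono[OF S x x'(1)] x' by simp
        then show ?thesis using x SS'D[OF S x] by (intro image_eqI[of _ _ x]) auto
      qed
    qed
    then have "card {b \<in> ?B. b \<le> y} \<le> card {2..x}"
      by (rule surj_card_le[rotated]) simp
    then show ?thesis using SS'D[OF S x] by (auto simp: least_preimage_def)
  qed
  have "\<beta> \<in> SS' n"
  proof (rule SS'I)
    fix x z assume "\<beta> x = Some z"
    then obtain y where y: "\<alpha> x = Some y" "z = ?c y" by (auto simp: \<beta>_def)
    then show "2 \<le> x \<and> x \<le> n \<and> 1 \<le> z \<and> z \<le> x"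
      using SS'D[OF S y(1)] le[OF y(1)] least_preimage_ge_2[OF fin ranI[of \<alpha>, OF y(1)]] by auto
  next
    fix x x' z z' assume "\<beta> x = Some z" "\<beta> x' = Some z'" "x < x'"
    then obtain y y' where y: "\<alpha> x = Some y" "z = ?c y" "\<alpha> x' = Some y'" "z' = ?c y'"
      by (auto simp: \<beta>_def)
    then have "y \<le> y'" using SS'_mono[OF S y(1,3)] \<open>x < x'\<close> by simp
    then show "z \<le> z'"
      using strict_mono_on_less_eq[OF sm, of y y'] y by (auto intro: ranI)
  qed
  moreover have "card (ran \<beta>) = p"
    using c card_image[OF strict_mono_on_imp_inj_on[OF sm]] by (simp add: ran\<beta>)
  ultimately have "\<beta> \<in> SS_rank n p" by (simp add: SS_rank_def)
  moreover have "1 \<notin> ran \<beta>" using least_preimage_ge_2[OF fin] by (fastforce simp: ran\<beta>)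
  moreover have "\<alpha> = pt_mult \<beta> (least_map ?B)"
  proof
    fix x
    show "\<alpha> x = pt_mult \<beta> (least_map ?B) x"
    proof (cases "\<alpha> x")
      case None
      then show ?thesis by (simp add: pt_mult_def \<beta>_def map_comp_def)
    next
      case (Some y)
      then have "least_map ?B (?c y) = Some y" by (auto simp: least_map_eq_Some[OF fin] intro: ranI)
      then show ?thesis using Some by (simp add: pt_mult_def \<beta>_def map_comp_def)
    qed
  qed
  ultimately show ?thesis using that by blast
qed

section \<open>Counting the idempotents\<close>

lemma SS_idem_one_notin_ran:
  assumes "\<epsilon> \<in> SS_idem n p"
  shows "1 \<notin> ran \<epsilon>"
  using assms SS'D(1)[of \<epsilon> n 1 1] by (auto simp: SS_idem_def SS_rank_def)

text \<open>By monotonicity, a fixed image point z \<le> x forces z to be at most the value at x. So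
  x goes to the largest image point not above it, and domain and image determine the
  idempotent.\<close>

lemma SS_idem_eq_Some:
  assumes "\<epsilon> \<in> SS_idem n p"
  shows "\<epsilon> x = Some y \<longleftrightarrow> x \<in> dom \<epsilon> \<and> y \<in> ran \<epsilon> \<and> y \<le> x \<and> (\<forall>z\<in>ran \<epsilon>. z \<le> x \<longrightarrow> z \<le> y)"
proof -
  have S: "\<epsilon> \<in> SS' n" and e: "\<And>y. y \<in> ran \<epsilon> \<Longrightarrow> \<epsilon> y = Some y"
    using assms by (auto simp: SS_idem_def SS_rank_def)
  have *: "y \<in> ran \<epsilon> \<and> y \<le> x \<and> (\<forall>z\<in>ran \<epsilon>. z \<le> x \<longrightarrow> z \<le> y)" if "\<epsilon> x = Some y" for y
    using that SS'D(4)[OF S that] SS'_mono[OF S e that] ranI[of \<epsilon>] by blast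
  show ?thesis
  proof
    assume "\<epsilon> x = Some y"
    then show "x \<in> dom \<epsilon> \<and> y \<in> ran \<epsilon> \<and> y \<le> x \<and> (\<forall>z\<in>ran \<epsilon>. z \<le> x \<longrightarrow> z \<le> y)"
      using * by blast
  next
    assume r: "x \<in> dom \<epsilon> \<and> y \<in> ran \<epsilon> \<and> y \<le> x \<and> (\<forall>z\<in>ran \<epsilon>. z \<le> x \<longrightarrow> z \<le> y)"
    then obtain w where w: "\<epsilon> x = Some w" by blast
    then have "w = y" using r *[OF w] by (meson le_antisym)
    then show "\<epsilon> x = Some y" using w by simp
  qed
qed

text \<open>The condition on \<open>Min D\<close> is what makes the rule "go to the largest point of
  M not above x" defined on all of D. It is necessary, since the image lies in the domain and the
  minimum can only go down to itself.\<close>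

lemma bij_betw_SS_idem:
  assumes p: "1 \<le> p"
  shows "bij_betw (\<lambda>\<epsilon>. (dom \<epsilon>, ran \<epsilon>)) (SS_idem n p)
    (SIGMA D:{D. D \<subseteq> {2..n} \<and> p \<le> card D}. {M. M \<subseteq> D \<and> Min D \<in> M \<and> card M = p})"
    (is "bij_betw ?f ?E ?P")
proof (rule bij_betw_imageI)
  show "inj_on ?f ?E"
  proof (rule inj_onI)
    fix \<epsilon> \<delta> assume h: "\<epsilon> \<in> ?E" "\<delta> \<in> ?E" "?f \<epsilon> = ?f \<delta>"
    then have "\<epsilon> x = Some y \<longleftrightarrow> \<delta> x = Some y" for x y
      by (simp add: SS_idem_eq_Some[OF h(1)] SS_idem_eq_Some[OF h(2)])
    then show "\<epsilon> = \<delta>" by (metis ext option.exhaust)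
  qed
  show "?f ` ?E = ?P"
  proof (intro equalityI subsetI)
    fix q assume "q \<in> ?f ` ?E"
    then obtain \<epsilon> where q: "q = (dom \<epsilon>, ran \<epsilon>)" and \<epsilon>: "\<epsilon> \<in> ?E" by blast
    have S: "\<epsilon> \<in> SS' n" and c: "card (ran \<epsilon>) = p" and e: "\<And>y. y \<in> ran \<epsilon> \<Longrightarrow> \<epsilon> y = Some y"
      using \<epsilon> by (auto simp: SS_idem_def SS_rank_def)
    have sub: "ran \<epsilon> \<subseteq> dom \<epsilon>" using e by blast
    have D: "dom \<epsilon> \<subseteq> {2..n}" using S by (simp add: SS'_iff)
    then have fin: "finite (dom \<epsilon>)" using finite_subset by blast
    have "ran \<epsilon> \<noteq> {}" using c p by auto
    then have "Min (dom \<epsilon>) \<in> dom \<epsilon>" using fin sub by (intro Min_in) auto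
    then obtain m where m: "\<epsilon> (Min (dom \<epsilon>)) = Some m" by blast
    then have "m \<in> dom \<epsilon>" using sub ranI[of \<epsilon>] by blast
    then have "m = Min (dom \<epsilon>)" using SS'D(4)[OF S m] Min_le[OF fin] by (meson le_antisym)
    then have "Min (dom \<epsilon>) \<in> ran \<epsilon>" using m ranI[of \<epsilon>] by metis
    then show "q \<in> ?P" using q sub D c card_mono[OF fin sub] by auto
  next
    fix q assume "q \<in> ?P"
    then obtain D M where q: "q = (D, M)" and D: "D \<subseteq> {2..n}" and M: "M \<subseteq> D" "Min D \<in> M"
      "card M = p" by auto
    have fin: "finite D" "finite M"
      using finite_subset[OF D] finite_subset[OF subset_trans[OF M(1) D]] by simp_all
    define \<epsilon> where "\<epsilon> = (\<lambda>x. if x \<in> D then Some (Max {m \<in> M. m \<le> x}) else None)"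
    have mx: "Max {m \<in> M. m \<le> x} \<in> {m \<in> M. m \<le> x}" if "x \<in> D" for x
      using that M(2) Min_le[OF fin(1) that] fin by (intro Max_in) auto
    have fixM: "Max {m \<in> M. m \<le> y} = y" if "y \<in> M" for y
      using that fin by (intro Max_eqI) auto
    have dom: "dom \<epsilon> = D" by (auto simp: \<epsilon>_def split: if_splits)
    have eM: "\<epsilon> y = Some y" if "y \<in> M" for y using fixM that M by (auto simp: \<epsilon>_def)
    have ran: "ran \<epsilon> = M"
    proof
      show "ran \<epsilon> \<subseteq> M" using mx by (auto simp: ran_def \<epsilon>_def split: if_splits)
      show "M \<subseteq> ran \<epsilon>" using eM by (meson ranI subsetI)
    qed
    have "\<epsilon> \<in> SS' n"
    proof (rule SS'I)
      fix x y assume "\<epsilon> x = Some y"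
      then have x: "x \<in> D" "y = Max {m \<in> M. m \<le> x}" by (auto simp: \<epsilon>_def split: if_splits)
      then have "y \<in> M" "y \<le> x" using mx by blast+
      moreover have "y \<in> {2..n}" "x \<in> {2..n}" using \<open>y \<in> M\<close> x M D by blast+
      ultimately show "2 \<le> x \<and> x \<le> n \<and> 1 \<le> y \<and> y \<le> x" by auto
    next
      fix x x' y y' assume "\<epsilon> x = Some y" "\<epsilon> x' = Some y'" "x < x'"
      then have x: "x \<in> D" "y = Max {m \<in> M. m \<le> x}" "y' = Max {m \<in> M. m \<le> x'}"
        by (auto simp: \<epsilon>_def split: if_splits)
      show "y \<le> y'" unfolding x
        by (rule Max_mono) (use mx[OF x(1)] \<open>x < x'\<close> fin in auto)
    qed
    then have "\<epsilon> \<in> ?E" using M eM by (auto simp: SS_idem_def SS_rank_def ran)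
    then show "q \<in> ?f ` ?E" using q dom ran by (intro image_eqI[of _ _ \<epsilon>]) auto
  qed
qed

lemma card_subsets_containing:
  assumes "finite D" "m \<in> D" "1 \<le> p"
  shows "card {M. M \<subseteq> D \<and> m \<in> M \<and> card M = p} = (card D - 1) choose (p - 1)"
proof -
  have "{M. M \<subseteq> D \<and> m \<in> M \<and> card M = p} = insert m ` {N. N \<subseteq> D - {m} \<and> card N = p - 1}"
  proof (intro equalityI subsetI)
    fix M assume "M \<in> {M. M \<subseteq> D \<and> m \<in> M \<and> card M = p}"
    then show "M \<in> insert m ` {N. N \<subseteq> D - {m} \<and> card N = p - 1}"
      by (intro image_eqI[of _ _ "M - {m}"]) auto
  next
    fix M assume "M \<in> insert m ` {N. N \<subseteq> D - {m} \<and> card N = p - 1}"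
    then obtain N where N: "M = insert m N" "N \<subseteq> D - {m}" "card N = p - 1" by blast
    moreover have "finite N" "m \<notin> N" using N assms(1) finite_subset by blast+
    ultimately show "M \<in> {M. M \<subseteq> D \<and> m \<in> M \<and> card M = p}" using assms by auto
  qed
  moreover have "inj_on (insert m) {N. N \<subseteq> D - {m} \<and> card N = p - 1}"
    by (rule inj_onI) (metis Diff_insert_absorb mem_Collect_eq subset_Diff_insert)
  ultimately show ?thesis using assms by (simp add: card_image n_subsets)
qed

text \<open>Although \<open>Min D\<close> varies with D, the number of admissible images depends
  only on the size r of D. Grouping the subsets of \<open>{2..n}\<close>, a set of n - 1 points, by
  r gives the sum.\<close>

lemma card_SS_idem:
  assumes p: "1 \<le> p"
  shows "finite (SS_idem n p)"
    and "card (SS_idem n p) = (\<Sum>r=p..n - 1. ((n - 1) choose r) * ((r - 1) choose (p - 1)))"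
proof -
  let ?Ds = "{D. D \<subseteq> {2..n} \<and> p \<le> card D}"
  let ?Ms = "\<lambda>D. {M. M \<subseteq> D \<and> Min D \<in> M \<and> card M = p}"
  have finD: "finite ?Ds" by simp
  have fin: "finite D" if "D \<in> ?Ds" for D using that finite_subset by blast
  have finM: "\<forall>D\<in>?Ds. finite (?Ms D)" using fin by auto
  then have "finite (Sigma ?Ds ?Ms)" using finD by (intro finite_SigmaI) auto
  then show "finite (SS_idem n p)" using bij_betw_finite[OF bij_betw_SS_idem[OF p]] by blast
  have cD: "card D \<in> {p..n - 1}" if "D \<in> ?Ds" for D
    using that card_mono[of "{2..n}" D] by auto
  have "card (SS_idem n p) = card (Sigma ?Ds ?Ms)"
    by (rule bij_betw_same_card[OF bij_betw_SS_idem[OF p]])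
  also have "\<dots> = (\<Sum>D\<in>?Ds. card (?Ms D))" using finD finM by (rule card_SigmaI)
  also have "\<dots> = (\<Sum>D\<in>?Ds. (card D - 1) choose (p - 1))"
  proof (rule sum.cong[OF refl])
    fix D assume D: "D \<in> ?Ds"
    then have "D \<noteq> {}" using p by auto
    then have "Min D \<in> D" using Min_in fin[OF D] by blast
    then show "card (?Ms D) = (card D - 1) choose (p - 1)"
      using card_subsets_containing[OF fin[OF D] _ p] by blast
  qed
  also have "\<dots> = (\<Sum>r=p..n - 1. \<Sum>D\<in>{D \<in> ?Ds. card D = r}. (card D - 1) choose (p - 1))"
    by (rule sum.group[symmetric]) (use finD cD in auto)
  also have "\<dots> = (\<Sum>r=p..n - 1. ((n - 1) choose r) * ((r - 1) choose (p - 1)))"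
  proof (rule sum.cong[OF refl])
    fix r assume r: "r \<in> {p..n - 1}"
    then have "{D \<in> ?Ds. card D = r} = {D. D \<subseteq> {2..n} \<and> card D = r}" by auto
    then have "card {D \<in> ?Ds. card D = r} = (n - 1) choose r"
      by (simp add: n_subsets)
    then show "(\<Sum>D\<in>{D \<in> ?Ds. card D = r}. (card D - 1) choose (p - 1))
      = ((n - 1) choose r) * ((r - 1) choose (p - 1))" by simp
  qed
  finally show "card (SS_idem n p) = (\<Sum>r=p..n - 1. ((n - 1) choose r) * ((r - 1) choose (p - 1)))" .
qed

section \<open>Matching the lower bound with a generating set\<close>

theorem theorem3p10:
  fixes n p :: nat
  assumes "n \<ge> 2" and "1 \<le> p" and "p \<le> n - 1"
  shows "semigroup_rank (RSS' n p) (RSS'_mult n p) =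
    ((n - 1) choose (p - 1)) + (\<Sum>r=p..n - 1. ((n - 1) choose r) * ((r - 1) choose (p - 1)))"
proof -
  let ?Bs = "{B. B \<subseteq> {1..n} \<and> 1 \<in> B \<and> card B = p}"
  let ?E = "SS_idem n p"
  let ?S = "RSS' n p"
  let ?gen = "generated_subsemigroup (RSS'_mult n p)"
  note p = assms(2)
  have pn: "p < n" using assms by simp
  have finB: "finite B" if "B \<in> ?Bs" for B using that finite_subset by blast
  have cB: "card ?Bs = (n - 1) choose (p - 1)" "finite ?Bs"
    using card_subsets_containing[of "{1..n}" 1 p] assms by auto
  have E_sub: "?E \<subseteq> SS_rank n p" by (auto simp: SS_idem_def)
  have lm: "least_map B \<in> SS_rank n p" if "B \<in> ?Bs" for B
    using that least_map_in_SS_rank pn by blast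
  \<comment> \<open>The forced idempotents never have 1 in their image, so they are disjoint from
    the generators needed to realize the images in \<open>?Bs\<close>, and the two counts add
    up.\<close>
  have lower: "card ?Bs + card ?E \<le> card A"
    if A: "A \<subseteq> ?S" "finite A" "?gen A = ?S" for A
  proof -
    let ?A1 = "{a \<in> A. 1 \<in> ran (the a)}"
    have EA: "Some ` ?E \<subseteq> A"
      using SS_idem_in_generators[OF p A(1)] E_sub by (auto simp: A(3) RSS'_eq[OF p])
    have "?Bs \<subseteq> (\<lambda>a. ran (the a)) ` ?A1"
    proof
      fix B assume B: "B \<in> ?Bs"
      then have "Some (least_map B) \<in> ?gen A" using lm A(3) RSS'_eq[OF p] by blast
      then obtain \<gamma> where "Some \<gamma> \<in> A" "ran \<gamma> = B"
        using ran_in_generators[OF p A(1)] ran_least_map[OF finB[OF B]] by metis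
      then show "B \<in> (\<lambda>a. ran (the a)) ` ?A1" using B by (intro image_eqI[of _ _ "Some \<gamma>"]) auto
    qed
    then have "card ?Bs \<le> card ?A1" using A(2) by (intro surj_card_le) auto
    moreover have "card (Some ` ?E) = card ?E" by (simp add: card_image)
    moreover have "card (?A1 \<union> Some ` ?E) = card ?A1 + card (Some ` ?E)"
      using A(2) card_SS_idem(1)[OF p] SS_idem_one_notin_ran
      by (intro card_Un_disjoint) fastforce+
    moreover have "card (?A1 \<union> Some ` ?E) \<le> card A" using EA A(2) by (intro card_mono) auto
    ultimately show ?thesis by linarith
  qed
  \<comment> \<open>Only an upper bound for the size of G is computed; equality follows from
    \<open>lower\<close> once G is known to generate.\<close>
  define G where "G = Some ` ?E \<union> (\<lambda>B. Some (least_map B)) ` ?Bs"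
  have G_sub: "G \<subseteq> ?S" using E_sub lm by (auto simp: G_def RSS'_eq[OF p])
  have G_fin: "finite G" using card_SS_idem(1)[OF p] cB by (simp add: G_def)
  have "card G \<le> card (Some ` ?E) + card ((\<lambda>B. Some (least_map B)) ` ?Bs)"
    unfolding G_def by (rule card_Un_le)
  also have "\<dots> \<le> card ?E + card ?Bs"
    using card_SS_idem(1)[OF p] cB(2) by (intro add_mono card_image_le)
  finally have G_card: "card G \<le> card ?Bs + card ?E" by simp
  have G_nonone: "Some \<alpha> \<in> ?gen G" if "\<alpha> \<in> SS_rank n p" "1 \<notin> ran \<alpha>" for \<alpha>
    using generated_by_SS_idem[OF p G_sub _ that] by (auto simp: G_def)
  have G_lm: "Some (least_map B) \<in> ?gen G" if "B \<in> ?Bs" for B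
    using that by (auto simp: G_def intro!: generated_subsemigroup.incl)
  have G_some: "Some \<alpha> \<in> ?gen G" if \<alpha>: "\<alpha> \<in> SS_rank n p" for \<alpha>
  proof (cases "1 \<in> ran \<alpha>")
    case True
    then have "ran \<alpha> \<in> ?Bs" using \<alpha> SS'_ran by (auto simp: SS_rank_def)
    then have l: "Some (least_map (ran \<alpha>)) \<in> ?gen G" by (rule G_lm)
    obtain \<beta> where \<beta>: "\<beta> \<in> SS_rank n p" "1 \<notin> ran \<beta>" "\<alpha> = pt_mult \<beta> (least_map (ran \<alpha>))"
      using factor_through_least_map[OF \<alpha>] .
    then show ?thesis using generated_pt_mult[OF p G_sub _ G_nonone l] \<alpha> by metis
  qed (use G_nonone \<alpha> in blast)
  \<comment> \<open>The zero must be generated as well. It arises as the square of a generator with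
    1 in its image; the set \<open>{1..p}\<close> supplies one.\<close>
  have "{1..p} \<in> ?Bs" using assms by auto
  then have b: "least_map {1..p} \<in> SS_rank n p" and b': "Some (least_map {1..p}) \<in> ?gen G"
    using lm G_lm by blast+
  \<comment> \<open>The square of a map with \<open>1\<close> in its image has smaller rank, since \<open>1\<close> is not in its domain.\<close>
  have "pt_mult (least_map {1..p}) (least_map {1..p}) \<notin> SS_rank n p"
  proof
    let ?g = "least_map {1..p}"
    assume "pt_mult ?g ?g \<in> SS_rank n p"
    then have r: "ran (pt_mult ?g ?g) = ran ?g" using ran_pt_mult_eq b by blast
    have S: "?g \<in> SS' n" using b by (simp add: SS_rank_def)
    have "ran ?g \<subseteq> (\<lambda>y. the (?g y)) ` (ran ?g - {1})"
    proof
      fix z assume "z \<in> ran ?g"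
      then obtain x y where "?g x = Some y" "?g y = Some z"
        using r by (auto simp: ran_def pt_mult_eq_Some set_eq_iff) metis
      then show "z \<in> (\<lambda>y. the (?g y)) ` (ran ?g - {1})"
        using SS'D(1)[OF S, of y z] by (intro image_eqI[of _ _ y]) (auto intro: ranI)
    qed
    then have "card (ran ?g) \<le> card (ran ?g - {1})"
      using SS'_finite_ran[OF S] by (intro surj_card_le) auto
    then show False using p by (simp add: ran_least_map)
  qed
  then have "RSS'_mult n p (Some (least_map {1..p})) (Some (least_map {1..p})) = None"
    using RSS'_mult_eq_Some[OF p, of "Some (least_map {1..p})" n "Some (least_map {1..p})"] b
    by (cases "RSS'_mult n p (Some (least_map {1..p})) (Some (least_map {1..p}))")
      (auto simp: RSS'_eq[OF p])
  then have "None \<in> ?gen G" using generated_subsemigroup.mult[OF b' b'] by metis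
  then have G_gen: "?gen G = ?S"
    using generated_subset_RSS'[OF p G_sub] G_some by (auto simp: RSS'_eq[OF p])
  have "semigroup_rank ?S (RSS'_mult n p) = card ?Bs + card ?E"
    unfolding semigroup_rank_def
  proof (rule Least_equality)
    show "\<exists>A\<subseteq>?S. finite A \<and> ?gen A = ?S \<and> card A = card ?Bs + card ?E"
      using G_sub G_fin G_gen G_card lower[of G] by (intro exI[of _ G]) auto
  qed (use lower in blast)
  then show ?thesis using cB card_SS_idem(2)[OF p] by simp
qed

end
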